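(* Fix $\alpha\in(0,1)$ and $\kappa>0$, and let $\mathcal X$ be a measurable space containing distinct points $x_0,x_D$ whose singletons are measurable. Let $$Q_X=\delta_{x_0},\qquad P_X=\frac1{1+\kappa}\delta_{x_0}+\frac{\kappa}{1+\kappa}\delta_{x_D},\qquad S^\star(x,y)=|y|-(1-\alpha),$$ so that $1+\chi^2(Q_X\Vert P_X)=1+\kappa$ and $P_X(\{x_0\})=(1+\chi^2(Q_X\Vert P_X))^{-1}$. Let $\widehat Q^w_m(x_0)$ be the weighted conformal threshold computed from $m$ source calibration observations with the fixed score $S^\star$ (see context). Then for every $m\ge1$ and $p\in[1,\infty]$, writing $\mathsf c=1+\chi^2(Q_X\Vert P_X)$, $$\sup_{P_{Y\mid X}}\mathbb E_{\mathcal D^{\rm cal}_m}\Bigl[\bigl\|\mathrm{Cov}^P_{\{S^\star\le\widehat Q^w_m(x_0)\}}(\cdot)-(1-\alpha)\bigr\|_{L^p(Q_X)}\Bigr]\le\frac32\sqrt{\frac{\mathsf c}{m+1}\Bigl[1-(1-\mathsf c^{-1})^{m+1}\Bigr]}\le\frac32\sqrt{\frac{\mathsf c}{m+1}},$$ where $\mathcal D^{\rm cal}_m\sim(P_X\otimes P_{Y\mid X})^{\otimes m}$ and the supremum is over all admissible conditional kernels (see context).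
   Context: $\chi^2(Q_X\Vert P_X)=\int(w-1)^2\,dP_X$ with $w=dQ_X/dP_X$; here $w(x_0)=1+\kappa$, $w(x_D)=0$. The score $S^\star$ is the equal-tailed oracle CQR score when the conditional law of $Y$ is uniform on $[-1,1]$ at every covariate value; it is held fixed for all kernels. Weighted conformal threshold: for calibration data $(X_i,Y_i)_{i=1}^m$, $\widehat Q^w_m(x_0)\in(-\infty,+\infty]$ is the $(1-\alpha)$-quantile (smallest $t$ such that $(-\infty,t]$ has mass at least $1-\alpha$, and $+\infty$ if no such real $t$ exists) of $$\sum_{j=1}^m\frac{w(X_j)}{\sum_{i=1}^mw(X_i)+w(x_0)}\,\delta_{S^\star(X_j,Y_j)}+\frac{w(x_0)}{\sum_{i=1}^mw(X_i)+w(x_0)}\,\delta_{+\infty}.$$ Coverage: for a realized sample and a threshold $q$, $\mathrm{Cov}^P_{\{S^\star\le q\}}(x)=P_{Y\mid X=x}(\{y:S^\star(x,y)\le q\})$. Admissible kernels: all conditional kernels $P_{Y\mid X}$ from $\mathcal X$ to $\mathbb R$ for which there are constants $0<\mu_{\rm low}\le\mu_{\rm up}<\infty$, $r_0>0$ and a measurable set $\mathcal X_0$ with $P_X(\mathcal X_0)=1$ such that for every $x\in\mathcal X_0$: $P_{Y\mid X=x}([u,v])\le\mu_{\rm up}(v-u)$ for all finite $u\le v$; and for $\tau\in\{\alpha/2,1-\alpha/2\}$, $0\le h\le r_0$, $P_{Y\mid X=x}([f_\tau(x)-h,f_\tau(x)])\ge\mu_{\rm low}h$ and $P_{Y\mid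 X=x}([f_\tau(x),f_\tau(x)+h])\ge\mu_{\rm low}h$, where $f_\tau(x)=\inf\{t:P_{Y\mid X=x}((-\infty,t])\ge\tau\}$. *)

theory Defs
  imports "HOL-Probability.Probability"
begin

definition measure_lincomb :: "real \<Rightarrow> 'a measure \<Rightarrow> real \<Rightarrow> 'a measure \<Rightarrow> 'a measure" where
  "measure_lincomb a \<mu> b \<nu> =
     measure_of (space \<mu>) (sets \<mu>) (\<lambda>A. ennreal a * emeasure \<mu> A + ennreal b * emeasure \<nu> A)"

lemma space_measure_lincomb [simp]: "space (measure_lincomb a \<mu> b \<nu>) = space \<mu>"
  and sets_measure_lincomb [simp, measurable_cong]: "sets (measure_lincomb a \<mu> b \<nu>) = sets \<mu>"
  by (simp_all add: measure_lincomb_def)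

lemma emeasure_measure_lincomb:
  assumes "sets \<nu> = sets \<mu>" "A \<in> sets \<mu>"
  shows "emeasure (measure_lincomb a \<mu> b \<nu>) A = ennreal a * emeasure \<mu> A + ennreal b * emeasure \<nu> A"
proof (rule emeasure_measure_of[OF measure_lincomb_def])
  show "sets \<mu> \<subseteq> Pow (space \<mu>)" by (rule sets.space_closed)
  show "positive (sets (measure_lincomb a \<mu> b \<nu>))
      (\<lambda>A. ennreal a * emeasure \<mu> A + ennreal b * emeasure \<nu> A)"
    by (simp add: positive_def)
  show "countably_additive (sets (measure_lincomb a \<mu> b \<nu>))
      (\<lambda>A. ennreal a * emeasure \<mu> A + ennreal b * emeasure \<nu> A)"
    using assms(1)
    by (auto simp: countably_additive_def suminf_add[symmetric] suminf_emeasure subset_eq)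
qed (use assms in simp)

text \<open>The value of the Radon--Nikodym derivative is determined by the two measures only almost
  everywhere; at an atom of the reference measure it is uniquely determined.\<close>

definition density_ratio :: "'a measure \<Rightarrow> 'a measure \<Rightarrow> 'a \<Rightarrow> real" where
  "density_ratio Q P x = enn2real (RN_deriv P Q x)"

text \<open>Only meaningful if \<open>Q\<close> is absolutely continuous with respect to \<open>P\<close> and the integrand is
  integrable.\<close>

definition chi_square_div :: "'a measure \<Rightarrow> 'a measure \<Rightarrow> real" where
  "chi_square_div Q P = (\<integral>x. (density_ratio Q P x - 1)\<^sup>2 \<partial>P)"

definition Lp_norm :: "ennreal \<Rightarrow> 'a measure \<Rightarrow> ('a \<Rightarrow> real) \<Rightarrow> ennreal" where
  "Lp_norm p M f =
     (if p = \<infinity> then esssup M (\<lambda>x. ennreal \<bar>f x\<bar>)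
      else let I = \<integral>\<^sup>+x. ennreal (\<bar>f x\<bar> powr enn2real p) \<partial>M
           in if I = \<infinity> then \<infinity> else ennreal (enn2real I powr (1 / enn2real p)))"

definition cond_quantile :: "('a \<Rightarrow> real measure) \<Rightarrow> real \<Rightarrow> 'a \<Rightarrow> real" where
  "cond_quantile K \<tau> x = Inf {t. \<tau> \<le> measure (K x) {..t}}"

definition admissible_kernels :: "real \<Rightarrow> 'a measure \<Rightarrow> ('a \<Rightarrow> real measure) set" where
  "admissible_kernels \<alpha> P =
     {K \<in> P \<rightarrow>\<^sub>M prob_algebra borel.
        \<exists>\<mu>low \<mu>up r\<^sub>0 :: real. \<exists>X\<^sub>0 \<in> sets P.
          0 < \<mu>low \<and> \<mu>low \<le> \<mu>up \<and> 0 < r\<^sub>0 \<and> emeasure P X\<^sub>0 = 1 \<and>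
          (\<forall>x\<in>X\<^sub>0.
             (\<forall>u v. u \<le> v \<longrightarrow> measure (K x) {u..v} \<le> \<mu>up * (v - u)) \<and>
             (\<forall>\<tau>\<in>{\<alpha>/2, 1 - \<alpha>/2}. \<forall>h. 0 \<le> h \<and> h \<le> r\<^sub>0 \<longrightarrow>
                measure (K x) {cond_quantile K \<tau> x - h .. cond_quantile K \<tau> x} \<ge> \<mu>low * h \<and>
                measure (K x) {cond_quantile K \<tau> x .. cond_quantile K \<tau> x + h} \<ge> \<mu>low * h))}"

definition joint_law :: "'a measure \<Rightarrow> ('a \<Rightarrow> real measure) \<Rightarrow> ('a \<times> real) measure" where
  "joint_law P K = P \<bind> (\<lambda>x. K x \<bind> (\<lambda>y. return (P \<Otimes>\<^sub>M borel) (x, y)))"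

definition calibration_law ::
    "nat \<Rightarrow> 'a measure \<Rightarrow> ('a \<Rightarrow> real measure) \<Rightarrow> (nat \<Rightarrow> 'a \<times> real) measure" where
  "calibration_law m P K = Pi\<^sub>M {..<m} (\<lambda>_. joint_law P K)"

text \<open>The mass which the weighted empirical score distribution, with an atom for the test point
  at \<open>\<infinity>\<close>, gives to the interval from \<open>-\<infinity>\<close> to \<open>t\<close>. The indicators are the values
  of the Dirac measures on this interval.\<close>

definition weighted_score_cdf ::
    "('a \<Rightarrow> real) \<Rightarrow> ('a \<Rightarrow> real \<Rightarrow> real) \<Rightarrow> 'a \<Rightarrow> nat \<Rightarrow> (nat \<Rightarrow> 'a \<times> real) \<Rightarrow> ereal \<Rightarrow> real" where
  "weighted_score_cdf w S x\<^sub>0 m D t =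
     (let W = (\<Sum>i<m. w (fst (D i))) + w x\<^sub>0
      in (\<Sum>j<m. w (fst (D j)) / W * indicator {..t} (ereal (S (fst (D j)) (snd (D j)))))
         + w x\<^sub>0 / W * indicator {..t} \<infinity>)"

definition weighted_conformal_threshold ::
    "real \<Rightarrow> ('a \<Rightarrow> real) \<Rightarrow> ('a \<Rightarrow> real \<Rightarrow> real) \<Rightarrow> 'a \<Rightarrow> nat \<Rightarrow> (nat \<Rightarrow> 'a \<times> real) \<Rightarrow> ereal" where
  "weighted_conformal_threshold \<alpha> w S x\<^sub>0 m D =
     (if \<exists>t::real. 1 - \<alpha> \<le> weighted_score_cdf w S x\<^sub>0 m D (ereal t)
      then ereal (LEAST t::real. 1 - \<alpha> \<le> weighted_score_cdf w S x\<^sub>0 m D (ereal t))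
      else \<infinity>)"

definition coverage :: "('a \<Rightarrow> real measure) \<Rightarrow> ('a \<Rightarrow> real \<Rightarrow> real) \<Rightarrow> ereal \<Rightarrow> 'a \<Rightarrow> real" where
  "coverage K S q x = measure (K x) {y. ereal (S x y) \<le> q}"

end

theory Submission
  imports Defs
begin

text \<open>
  The target \<open>Q\<close> is a point mass at \<open>x\<^sub>0\<close>, so every \<open>L\<^sup>p(Q)\<close> norm is the absolute value at \<open>x\<^sub>0\<close>, and
  the weight function vanishes at the decoy \<open>x\<^sub>D\<close>. Write \<open>a = 1 - \<alpha>\<close> and let \<open>N\<close> be the number of
  calibration covariates equal to \<open>x\<^sub>0\<close>, a binomial variable with parameters \<open>m\<close> and
  \<open>p = P {x\<^sub>0} = 1 / \<c>\<close>. The weighted threshold is then the ordinary split conformal threshold of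
  these \<open>N\<close> points (\<open>weighted_score_cdf_two_point\<close>), that is, their score of rank
  \<open>k = \<lceil>a (N + 1)\<rceil>\<close>, or \<open>\<infinity>\<close> if \<open>k = N + 1\<close>. Only the effective sample size \<open>N\<close> is left of the
  \<open>m\<close> observations, and this is the loss expressed by the factor \<open>\<c>\<close>.

  Admissibility makes the conditional law at \<open>x\<^sub>0\<close> free of atoms, hence the score has a continuous
  distribution function \<open>F\<close> there, and the coverage \<open>V\<close> is the value of \<open>F\<close> at the threshold: given
  \<open>N\<close>, the \<open>k\<close>-th order statistic of \<open>N\<close> uniform variables, or \<open>1\<close> if \<open>k = N + 1\<close>. Its variance is at most
  \<open>1 / (4 (N + 2))\<close> and its bias for \<open>a\<close> is at most \<open>1 / (N + 1)\<close>, so that its mean squared deviation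
  from \<open>a\<close> is at most \<open>9 / (4 (N + 1))\<close>. The binomial mean of \<open>1 / (N + 1)\<close> is
  \<open>\<c> / (m + 1) (1 - (1 - 1 / \<c>)\<^bsup>m + 1\<^esup>)\<close>, and Jensen's inequality passes from the second moment to
  the mean absolute deviation.

  Order statistics and conditional laws enter only through tail probabilities. The event \<open>V > t\<close> says
  that fewer than \<open>a (N + 1)\<close> of the points at \<open>x\<^sub>0\<close> have a score up to the \<open>t\<close>-quantile
  (\<open>weighted_conformal_threshold_le_iff\<close>, \<open>continuous_score_quantile\<close>). Its probability is a double
  binomial sum (\<open>measure_PiM_nested_counts\<close>), and the second moment of \<open>V - a\<close> is obtained by
  integrating it against \<open>2 (t - a)\<close> over the unit interval (\<open>second_moment_layer_cake\<close>), where each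
  binomial term is a Beta integral.
\<close>

section \<open>The weighted conformal threshold\<close>

text \<open>Below \<open>\<infinity>\<close> the atom of the test point contributes only through the normalisation.\<close>

lemma weighted_score_cdf_real:
  "weighted_score_cdf w S x\<^sub>0 m D (ereal t) =
     (\<Sum>j\<in>{j. j < m \<and> S (fst (D j)) (snd (D j)) \<le> t}. w (fst (D j))) /
       ((\<Sum>i<m. w (fst (D i))) + w x\<^sub>0)"
proof -
  have "(\<Sum>j<m. w (fst (D j)) / W * indicator {..ereal t} (ereal (S (fst (D j)) (snd (D j))))) =
      (\<Sum>j\<in>{j. j < m \<and> S (fst (D j)) (snd (D j)) \<le> t}. w (fst (D j)) / W)" for W
    by (intro sum.mono_neutral_cong_right) (auto simp: indicator_def)
  then show ?thesis
    by (simp add: weighted_score_cdf_def Let_def sum_divide_distrib)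
qed

text \<open>The usual Galois connection between a quantile and its distribution function. It presupposes
  that the infimum defining the quantile is attained, which holds because the function jumps only
  at the finitely many calibration scores; since \<open>1 - \<alpha>\<close> is positive, the level set can be
  retracted onto those scores.\<close>

lemma weighted_conformal_threshold_le_iff:
  assumes "\<And>x. 0 \<le> w x" and "\<alpha> < 1"
  shows "weighted_conformal_threshold \<alpha> w S x\<^sub>0 m D \<le> ereal s \<longleftrightarrow>
    1 - \<alpha> \<le> weighted_score_cdf w S x\<^sub>0 m D (ereal s)"
proof -
  define sc where "sc j = S (fst (D j)) (snd (D j))" for j
  define G where "G t = weighted_score_cdf w S x\<^sub>0 m D (ereal t)" for t
  define W where "W = (\<Sum>i<m. w (fst (D i))) + w x\<^sub>0"
  have G: "G t = (\<Sum>j\<in>{j. j < m \<and> sc j \<le> t}. w (fst (D j))) / W" for t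
    by (simp add: G_def W_def sc_def weighted_score_cdf_real)
  have W: "0 \<le> W" by (simp add: W_def assms sum_nonneg)
  have mono: "G t \<le> G u" if "t \<le> u" for t u
    unfolding G using that assms W by (intro divide_right_mono sum_mono2) auto
  have least: "\<exists>t'. 1 - \<alpha> \<le> G t' \<and> t' \<in> sc ` {..<m} \<and> t' \<le> t" if t: "1 - \<alpha> \<le> G t" for t
  proof -
    let ?J = "{j. j < m \<and> sc j \<le> t}"
    have "?J \<noteq> {}"
    proof
      assume "?J = {}"
      then have "G t = 0" unfolding G by (simp only: sum.empty div_0)
      with t assms(2) show False by simp
    qed
    then have max: "Max (sc ` ?J) \<in> sc ` ?J" by (intro Max_in) auto
    \<comment> \<open>moving down to the largest score below \<open>t\<close> passes no jump\<close>
    have "{j. j < m \<and> sc j \<le> Max (sc ` ?J)} = ?J"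
      using max by (auto intro!: Max_ge)
    then have "G (Max (sc ` ?J)) = G t" unfolding G by simp
    with t have "1 - \<alpha> \<le> G (Max (sc ` ?J))" by simp
    moreover have "Max (sc ` ?J) \<in> sc ` {..<m}" "Max (sc ` ?J) \<le> t" using max by auto
    ultimately show ?thesis by blast
  qed
  show ?thesis
  proof (cases "\<exists>t. 1 - \<alpha> \<le> G t")
    case True
    let ?T = "{t \<in> sc ` {..<m}. 1 - \<alpha> \<le> G t}"
    have finT: "finite ?T" by simp
    have "?T \<noteq> {}" using True least by blast
    then have Min: "Min ?T \<in> ?T" by (intro Min_in) auto
    have L: "(LEAST t. 1 - \<alpha> \<le> G t) = Min ?T"
    proof (rule Least_equality)
      show "1 - \<alpha> \<le> G (Min ?T)" using Min by simp
      fix y assume "1 - \<alpha> \<le> G y"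
      from least[OF this] obtain t' where "t' \<in> ?T" "t' \<le> y" by auto
      then show "Min ?T \<le> y" using Min_le[OF finT] order_trans by blast
    qed
    have "weighted_conformal_threshold \<alpha> w S x\<^sub>0 m D = ereal (Min ?T)"
      using True L unfolding weighted_conformal_threshold_def G_def by simp
    moreover have "Min ?T \<le> s \<longleftrightarrow> 1 - \<alpha> \<le> G s"
    proof
      assume "Min ?T \<le> s"
      then have "G (Min ?T) \<le> G s" by (rule mono)
      with Min show "1 - \<alpha> \<le> G s" by simp
    next
      assume "1 - \<alpha> \<le> G s"
      from least[OF this] obtain t' where "t' \<in> ?T" "t' \<le> s" by auto
      then show "Min ?T \<le> s" using Min_le[OF finT] order_trans by blast
    qed
    ultimately show ?thesis by (simp add: G_def)
  next
    case False
    then show ?thesis unfolding weighted_conformal_threshold_def G_def by auto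
  qed
qed

text \<open>On these calibration points the weights take only the values \<open>w x\<^sub>0\<close> and \<open>0\<close>, so
  the common factor \<open>w x\<^sub>0\<close> cancels: what remains is the unweighted conformal procedure applied to the calibration points at \<open>x\<^sub>0\<close>.\<close>

lemma weighted_score_cdf_two_point:
  assumes "0 < w x\<^sub>0" and "w x\<^sub>D = 0" and "\<And>i. i < m \<Longrightarrow> fst (D i) \<in> {x\<^sub>0, x\<^sub>D}"
  shows "weighted_score_cdf w S x\<^sub>0 m D (ereal t) =
    real (card {i. i < m \<and> D i \<in> {x\<^sub>0} \<times> {y. S x\<^sub>0 y \<le> t}}) /
    real (card {i. i < m \<and> D i \<in> {x\<^sub>0} \<times> UNIV} + 1)"
proof -
  have eq: "(\<Sum>i\<in>I. w (fst (D i))) = w x\<^sub>0 * real (card {i\<in>I. fst (D i) = x\<^sub>0})"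
    if I: "I \<subseteq> {..<m}" for I
  proof -
    have "finite I" using I finite_subset by blast
    have "(\<Sum>i\<in>I. w (fst (D i))) = (\<Sum>i\<in>{i\<in>I. fst (D i) = x\<^sub>0}. w x\<^sub>0)"
      using \<open>finite I\<close> I assms by (intro sum.mono_neutral_cong_right) auto
    then show ?thesis by simp
  qed
  have A: "{i \<in> {j. j < m \<and> S (fst (D j)) (snd (D j)) \<le> t}. fst (D i) = x\<^sub>0} =
      {i. i < m \<and> D i \<in> {x\<^sub>0} \<times> {y. S x\<^sub>0 y \<le> t}}"
    by (auto simp: mem_Times_iff)
  have B: "{i \<in> {..<m}. fst (D i) = x\<^sub>0} = {i. i < m \<and> D i \<in> {x\<^sub>0} \<times> UNIV}"
    by (auto simp: mem_Times_iff)
  have "w x\<^sub>0 * real n + w x\<^sub>0 = w x\<^sub>0 * real (n + 1)" for n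
    by (simp add: algebra_simps)
  then show ?thesis
    unfolding weighted_score_cdf_real
    using assms(1) eq[of "{j. j < m \<and> S (fst (D j)) (snd (D j)) \<le> t}", unfolded A] eq[of "{..<m}", unfolded B]
    by (simp add: subset_eq del: of_nat_add of_nat_Suc mem_Times_iff)
qed

lemma borel_measurable_weighted_score_cdf:
  assumes w: "w \<in> borel_measurable P" and S: "(\<lambda>z. S (fst z) (snd z)) \<in> borel_measurable (P \<Otimes>\<^sub>M borel)"
    and N: "sets N = sets (P \<Otimes>\<^sub>M borel)"
  shows "(\<lambda>D. weighted_score_cdf w S x\<^sub>0 m D (ereal t)) \<in> borel_measurable (Pi\<^sub>M {..<m} (\<lambda>_. N))"
proof -
  have comp: "(\<lambda>D. D j) \<in> Pi\<^sub>M {..<m} (\<lambda>_. N) \<rightarrow>\<^sub>M P \<Otimes>\<^sub>M borel" if "j < m" for j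
    using measurable_component_singleton[of j "{..<m}" "\<lambda>_. N"] that
    by (simp add: measurable_cong_sets[OF refl N])
  have W: "(\<lambda>D. w (fst (D j))) \<in> borel_measurable (Pi\<^sub>M {..<m} (\<lambda>_. N))" if "j < m" for j
    using measurable_compose[OF comp[OF that] measurable_compose[OF measurable_fst w]] .
  have "(\<lambda>D. S (fst (D j)) (snd (D j))) \<in> borel_measurable (Pi\<^sub>M {..<m} (\<lambda>_. N))" if "j < m" for j
    using measurable_compose[OF comp[OF that] S] .
  then have ind: "(\<lambda>D. indicator {..t} (S (fst (D j)) (snd (D j))) :: real) \<in> borel_measurable (Pi\<^sub>M {..<m} (\<lambda>_. N))"
    if "j < m" for j
    using that by (intro measurable_compose[OF _ borel_measurable_indicator]) auto
  have eq: "indicator {..ereal t} (ereal x) = (indicator {..t} x :: real)" for x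
    by (simp add: indicator_def)
  show ?thesis
    unfolding weighted_score_cdf_def Let_def eq
    by (intro borel_measurable_add borel_measurable_sum borel_measurable_times borel_measurable_divide
        borel_measurable_const W ind) simp_all
qed

text \<open>For a continuous distribution function \<open>F\<close> the event \<open>F q > t\<close> is the event \<open>q > s\<close>, where \<open>s\<close> is
  the largest \<open>t\<close>-quantile; \<open>q = \<infinity>\<close> is included. This turns a statement on the coverage of
  a random threshold into one on the threshold itself. The lower witness \<open>s\<^sub>1\<close> excludes the case that
  the \<open>t\<close>-quantile is \<open>-\<infinity>\<close>, which could occur for \<open>t = 0\<close>.\<close>

lemma continuous_score_quantile:
  fixes g :: "real \<Rightarrow> real"
  assumes "prob_space \<mu>" and [measurable_cong]: "sets \<mu> = sets borel" and [measurable]: "g \<in> borel_measurable borel"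
    and noatom: "\<And>s. measure \<mu> {y. g y = s} = 0"
    and "0 \<le> t" "t < 1" and "measure \<mu> {y. g y \<le> s\<^sub>1} \<le> t"
  obtains s where "measure \<mu> {y. g y \<le> s} = t"
    and "\<And>q. t < measure \<mu> {y. ereal (g y) \<le> q} \<longleftrightarrow> ereal s < q"
proof -
  interpret prob_space \<mu> by fact
  have sp: "space \<mu> = UNIV" using sets_eq_imp_space_eq[OF assms(2)] by simp
  define \<nu> where "\<nu> = distr \<mu> borel g"
  interpret \<nu>: real_distribution \<nu>
    unfolding \<nu>_def by (rule real_distribution_distr) simp
  define F where "F = cdf \<nu>"
  have F: "F s = measure \<mu> {y. g y \<le> s}" for s
    unfolding F_def cdf_def \<nu>_def
    by (subst measure_distr) (auto simp: sp vimage_def)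
  have cont: "isCont F s" for s
    unfolding F_def
  proof (subst \<nu>.isCont_cdf)
    show "measure \<nu> {s} = 0"
      using noatom[of s] unfolding \<nu>_def by (subst measure_distr) (auto simp: sp vimage_def)
  qed
  have mono: "F x \<le> F y" if "x \<le> y" for x y
    unfolding F_def by (rule \<nu>.cdf_nondecreasing[OF that])
  have "eventually (\<lambda>x. t < F x) at_top"
    using order_tendstoD(1)[OF \<nu>.cdf_lim_at_top_prob \<open>t < 1\<close>] by (simp add: F_def)
  then obtain b where b: "t < F b" by (auto simp: eventually_at_top_linorder)
  \<comment> \<open>the largest quantile, not the smallest: on a flat piece of \<open>F\<close> only its right end
    separates \<open>F \<le> t\<close> from \<open>F > t\<close>\<close>
  define T where "T = {s. F s \<le> t}"
  have "closed T" unfolding T_def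
    using cont by (intro closed_Collect_le continuous_at_imp_continuous_on) auto
  have ne: "s\<^sub>1 \<in> T" using assms(7) by (simp add: T_def F)
  have bdd: "bdd_above T"
    using b mono unfolding T_def by (intro bdd_aboveI[of _ b]) (smt (verit) mem_Collect_eq)
  define s where "s = Sup T"
  have sT: "s \<in> T" unfolding s_def using \<open>closed T\<close> ne bdd by (intro closed_contains_Sup) auto
  have above: "t < F x" if "s < x" for x
    using that cSup_upper[OF _ bdd, of x] unfolding s_def T_def by force
  have Fs: "F s = t"
  proof (rule ccontr)
    assume "F s \<noteq> t"
    then have "F s < t" using sT by (simp add: T_def)
    then have "eventually (\<lambda>x. F x < t) (at s)"
      using cont[of s] unfolding isCont_def by (rule order_tendstoD(2)[rotated])
    then have "eventually (\<lambda>x. F x < t) (at_right s)"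
      by (simp add: eventually_at_split)
    then obtain b where "s < b" "\<And>y. s < y \<Longrightarrow> y < b \<Longrightarrow> F y < t"
      unfolding eventually_at_right_field by blast
    with above dense[of s b] show False by (meson less_asym)
  qed
  have "t < measure \<mu> {y. ereal (g y) \<le> q} \<longleftrightarrow> ereal s < q" for q
  proof (cases q)
    case (real r)
    have "t < F r \<longleftrightarrow> s < r"
      using above[of r] mono[of r s] Fs by force
    then show ?thesis using real by (simp add: F)
  next
    case PInf
    then show ?thesis using \<open>t < 1\<close> prob_space by (simp add: sp)
  next
    case MInf
    then show ?thesis using \<open>0 \<le> t\<close> by simp
  qed
  with Fs show ?thesis by (intro that[of s]) (simp_all add: F)
qed

section \<open>Counts in nested sets under a product measure\<close>

lemma sum_Pow_card:
  fixes h :: "nat \<Rightarrow> real"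
  assumes "finite A"
  shows "(\<Sum>I\<in>Pow A. h (card I)) = (\<Sum>n\<le>card A. real (card A choose n) * h n)"
proof -
  have "(\<Sum>I\<in>Pow A. h (card I)) = (\<Sum>n\<le>card A. \<Sum>I\<in>{I\<in>Pow A. card I = n}. h (card I))"
    using assms by (subst sum.group) (auto intro: card_mono)
  also have "\<dots> = (\<Sum>n\<le>card A. real (card A choose n) * h n)"
    using n_subsets[OF assms] by (intro sum.cong refl) simp
  finally show ?thesis .
qed

text \<open>The count of \<open>B\<close> is binomial with parameter \<open>p\<close>, and given its value \<open>n\<close> the count of the smaller
  set \<open>A\<close> is binomial with parameters \<open>n\<close> and \<open>t\<close>. To avoid conditioning, the event is cut into
  the boxes on which the index sets \<open>I\<close> of points in \<open>B\<close> and \<open>J\<close> of points in \<open>A\<close> are prescribed;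
  each box has product measure, and only the cardinalities of \<open>I\<close> and \<open>J\<close> matter.\<close>

lemma measure_PiM_nested_counts:
  fixes N :: "'a measure" and R :: "nat \<Rightarrow> nat \<Rightarrow> bool"
  assumes "prob_space N" and [measurable]: "A \<in> sets N" "B \<in> sets N" and "A \<subseteq> B"
    and mA: "measure N A = p * t" and mB: "measure N B = p"
  shows "measure (Pi\<^sub>M {..<m} (\<lambda>_. N))
      {D \<in> space (Pi\<^sub>M {..<m} (\<lambda>_. N)). R (card {i. i < m \<and> D i \<in> B}) (card {i. i < m \<and> D i \<in> A})} =
    (\<Sum>n\<le>m. real (m choose n) * p ^ n * (1 - p) ^ (m - n) *
      (\<Sum>j | j \<le> n \<and> R n j. real (n choose j) * t ^ j * (1 - t) ^ (n - j)))"
proof -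
  interpret N: prob_space N by fact
  interpret PN: product_prob_space "\<lambda>_. N" "{..<m}" ..
  let ?P = "Pi\<^sub>M {..<m} (\<lambda>_. N)"
  \<comment> \<open>the sides of the box on which exactly the indices in \<open>I\<close> hit \<open>B\<close> and those in \<open>J\<close> hit \<open>A\<close>\<close>
  define c where "c I J i = (if i \<in> J then A else if i \<in> I then B - A else space N - B)" for I J and i :: nat
  define E where "E I J = Pi\<^sub>E {..<m} (c I J)" for I J
  have c_sets: "c I J i \<in> sets N" for I J i by (auto simp: c_def)
  have AB: "A \<subseteq> space N" "B \<subseteq> space N" by (simp_all add: sets.sets_into_space)
  have E_sets: "E I J \<in> sets ?P" for I J
    unfolding E_def by (intro sets_PiM_I_finite) (auto simp: c_sets)
  have E_iff: "D \<in> E I J \<longleftrightarrow> {i. i < m \<and> D i \<in> B} = I \<and> {i. i < m \<and> D i \<in> A} = J"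
    if "D \<in> space ?P" "I \<subseteq> {..<m}" "J \<subseteq> I" for D I J
  proof -
    have ext: "D \<in> extensional {..<m}" and sp: "\<And>i. i < m \<Longrightarrow> D i \<in> space N"
      using that(1) by (auto simp: space_PiM PiE_iff)
    have "D i \<in> c I J i \<longleftrightarrow> (D i \<in> B \<longleftrightarrow> i \<in> I) \<and> (D i \<in> A \<longleftrightarrow> i \<in> J)" if "i < m" for i
      using sp[OF that] \<open>J \<subseteq> I\<close> \<open>A \<subseteq> B\<close> by (auto simp: c_def)
    then have "D \<in> E I J \<longleftrightarrow> (\<forall>i<m. (D i \<in> B \<longleftrightarrow> i \<in> I) \<and> (D i \<in> A \<longleftrightarrow> i \<in> J))"
      using ext by (auto simp: E_def PiE_iff)
    also have "\<dots> \<longleftrightarrow> {i. i < m \<and> D i \<in> B} = I \<and> {i. i < m \<and> D i \<in> A} = J"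
      using that(2,3) by blast
    finally show ?thesis .
  qed
  have mc: "measure N (c I J i) = (if i \<in> J then p * t else if i \<in> I then p * (1 - t) else 1 - p)" for I J i
    using \<open>A \<subseteq> B\<close> by (auto simp: c_def mA mB N.finite_measure_Diff N.prob_compl algebra_simps)
  have mE: "measure ?P (E I J) = p ^ card I * (1 - p) ^ (m - card I) * (t ^ card J * (1 - t) ^ (card I - card J))"
    if IJ: "I \<subseteq> {..<m}" "J \<subseteq> I" for I J
  proof -
    have fin: "finite I" "finite J"
      using finite_subset[OF IJ(1)] finite_subset[OF IJ(2)] by simp_all
    have "emeasure ?P (E I J) = (\<Prod>i<m. emeasure N (c I J i))"
      unfolding E_def by (intro PN.emeasure_PiM) (auto simp: c_sets)
    then have "measure ?P (E I J) = (\<Prod>i<m. measure N (c I J i))"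
      by (simp add: N.emeasure_eq_measure PN.emeasure_eq_measure prod_ennreal prod_nonneg)
    also have "\<dots> = (\<Prod>i\<in>I. measure N (c I J i)) * (\<Prod>i\<in>{..<m} - I. measure N (c I J i))"
      using IJ prod.subset_diff[of I "{..<m}"] by (simp add: mult.commute)
    also have "(\<Prod>i\<in>{..<m} - I. measure N (c I J i)) = (1 - p) ^ (m - card I)"
    proof -
      have "(\<Prod>i\<in>{..<m} - I. measure N (c I J i)) = (\<Prod>i\<in>{..<m} - I. 1 - p)"
        using IJ by (intro prod.cong) (auto simp: mc)
      then show ?thesis using IJ fin by (simp add: card_Diff_subset)
    qed
    also have "(\<Prod>i\<in>I. measure N (c I J i)) = (\<Prod>i\<in>J. measure N (c I J i)) * (\<Prod>i\<in>I - J. measure N (c I J i))"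
      using IJ fin prod.subset_diff[of J I] by (simp add: mult.commute)
    also have "(\<Prod>i\<in>J. measure N (c I J i)) = (p * t) ^ card J"
      by (simp add: mc)
    also have "(\<Prod>i\<in>I - J. measure N (c I J i)) = (p * (1 - t)) ^ (card I - card J)"
    proof -
      have "(\<Prod>i\<in>I - J. measure N (c I J i)) = (\<Prod>i\<in>I - J. p * (1 - t))"
        using IJ by (intro prod.cong) (auto simp: mc)
      then show ?thesis using IJ fin by (simp add: card_Diff_subset)
    qed
    finally have "measure ?P (E I J) =
        (p ^ card J * p ^ (card I - card J)) * (1 - p) ^ (m - card I) * (t ^ card J * (1 - t) ^ (card I - card J))"
      by (simp add: power_mult_distrib mult_ac)
    also have "p ^ card J * p ^ (card I - card J) = p ^ card I"
      using card_mono[OF fin(1) IJ(2)] by (simp flip: power_add)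
    finally show ?thesis .
  qed
  let ?Z = "SIGMA I:Pow {..<m}. {J \<in> Pow I. R (card I) (card J)}"
  have finJ: "finite {J \<in> Pow I. R (card I) (card J)}" if "I \<in> Pow {..<m}" for I
  proof (rule finite_subset)
    have "finite I" using that by (auto dest: finite_subset)
    then show "finite (Pow I)" by simp
  qed blast
  have finZ: "finite ?Z"
    by (rule finite_SigmaI[OF _ finJ]) simp
  have "{D \<in> space ?P. R (card {i. i < m \<and> D i \<in> B}) (card {i. i < m \<and> D i \<in> A})} = (\<Union>z\<in>?Z. E (fst z) (snd z))"
  proof (intro subset_antisym subsetI)
    fix D assume D: "D \<in> {D \<in> space ?P. R (card {i. i < m \<and> D i \<in> B}) (card {i. i < m \<and> D i \<in> A})}"
    let ?I = "{i. i < m \<and> D i \<in> B}" and ?J = "{i. i < m \<and> D i \<in> A}"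
    have "(?I, ?J) \<in> ?Z" using D \<open>A \<subseteq> B\<close> by auto
    moreover have "D \<in> E ?I ?J" using D \<open>A \<subseteq> B\<close> by (subst E_iff) auto
    ultimately show "D \<in> (\<Union>z\<in>?Z. E (fst z) (snd z))"
      by (intro UN_I[of "(?I, ?J)"]) (simp_all only: fst_conv snd_conv)
  next
    fix D assume "D \<in> (\<Union>z\<in>?Z. E (fst z) (snd z))"
    then obtain I J where IJ: "I \<subseteq> {..<m}" "J \<subseteq> I" "R (card I) (card J)" and D: "D \<in> E I J" by auto
    have sp: "D \<in> space ?P" using D sets.sets_into_space[OF E_sets] by blast
    show "D \<in> {D \<in> space ?P. R (card {i. i < m \<and> D i \<in> B}) (card {i. i < m \<and> D i \<in> A})}"
      using D IJ(3) sp unfolding E_iff[OF sp IJ(1,2)] by auto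
  qed
  also have "measure ?P \<dots> = (\<Sum>z\<in>?Z. measure ?P (E (fst z) (snd z)))"
  proof (rule PN.finite_measure_finite_Union[OF finZ])
    show "(\<lambda>z. E (fst z) (snd z)) ` ?Z \<subseteq> sets ?P" using E_sets by auto
    show "disjoint_family_on (\<lambda>z. E (fst z) (snd z)) ?Z"
      unfolding disjoint_family_on_def
    proof (intro ballI impI, rule ccontr)
      fix y z assume yz: "y \<in> ?Z" "z \<in> ?Z" "y \<noteq> z" and "E (fst y) (snd y) \<inter> E (fst z) (snd z) \<noteq> {}"
      then obtain D where D: "D \<in> E (fst y) (snd y)" "D \<in> E (fst z) (snd z)" by auto
      have sp: "D \<in> space ?P" using D(1) sets.sets_into_space[OF E_sets] by blast
      have "fst y = fst z \<and> snd y = snd z"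
        using D yz(1,2) E_iff[OF sp, of "fst y" "snd y"] E_iff[OF sp, of "fst z" "snd z"]
        by (cases y, cases z) auto
      with yz(3) show False by (simp add: prod_eq_iff)
    qed
  qed
  also have "\<dots> = (\<Sum>I\<in>Pow {..<m}. \<Sum>J\<in>{J \<in> Pow I. R (card I) (card J)}. measure ?P (E I J))"
  proof -
    have "\<forall>I\<in>Pow {..<m}. finite {J \<in> Pow I. R (card I) (card J)}" using finJ by blast
    from sum.Sigma[OF _ this, of "\<lambda>I J. measure ?P (E I J)"] show ?thesis
      by (simp only: finite_Pow_iff finite_lessThan case_prod_unfold)
  qed
  also have "\<dots> = (\<Sum>I\<in>Pow {..<m}. p ^ card I * (1 - p) ^ (m - card I) *
      (\<Sum>J\<in>Pow I. if R (card I) (card J) then t ^ card J * (1 - t) ^ (card I - card J) else 0))"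
  proof (intro sum.cong refl)
    fix I assume I: "I \<in> Pow {..<m}"
    then have fin: "finite I" by (auto dest: finite_subset)
    have "(\<Sum>J\<in>{J \<in> Pow I. R (card I) (card J)}. measure ?P (E I J)) =
        (\<Sum>J\<in>{J \<in> Pow I. R (card I) (card J)}. p ^ card I * (1 - p) ^ (m - card I) * (t ^ card J * (1 - t) ^ (card I - card J)))"
      using I by (intro sum.cong refl mE) auto
    also have "\<dots> = p ^ card I * (1 - p) ^ (m - card I) *
      (\<Sum>J\<in>Pow I. if R (card I) (card J) then t ^ card J * (1 - t) ^ (card I - card J) else 0)"
      unfolding sum_distrib_left[symmetric] using fin by (subst sum.inter_filter) auto
    finally show "(\<Sum>J\<in>{J \<in> Pow I. R (card I) (card J)}. measure ?P (E I J)) = \<dots>" .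
  qed
  also have "\<dots> = (\<Sum>I\<in>Pow {..<m}. p ^ card I * (1 - p) ^ (m - card I) *
      (\<Sum>j\<le>card I. real (card I choose j) * (if R (card I) j then t ^ j * (1 - t) ^ (card I - j) else 0)))"
    by (intro sum.cong refl arg_cong2[where f = "(*)"] sum_Pow_card) (auto dest: finite_subset)
  also have "\<dots> = (\<Sum>n\<le>m. real (m choose n) * (p ^ n * (1 - p) ^ (m - n) *
      (\<Sum>j\<le>n. real (n choose j) * (if R n j then t ^ j * (1 - t) ^ (n - j) else 0))))"
    by (subst sum_Pow_card) auto
  also have "\<dots> = (\<Sum>n\<le>m. real (m choose n) * p ^ n * (1 - p) ^ (m - n) *
      (\<Sum>j | j \<le> n \<and> R n j. real (n choose j) * t ^ j * (1 - t) ^ (n - j)))"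
  proof (intro sum.cong refl)
    fix n
    have "(\<Sum>j\<le>n. real (n choose j) * (if R n j then t ^ j * (1 - t) ^ (n - j) else 0)) =
       (\<Sum>j | j \<le> n \<and> R n j. real (n choose j) * t ^ j * (1 - t) ^ (n - j))"
      by (intro sum.mono_neutral_cong_right) auto
    then show "real (m choose n) * (p ^ n * (1 - p) ^ (m - n) *
      (\<Sum>j\<le>n. real (n choose j) * (if R n j then t ^ j * (1 - t) ^ (n - j) else 0))) =
      real (m choose n) * p ^ n * (1 - p) ^ (m - n) *
      (\<Sum>j | j \<le> n \<and> R n j. real (n choose j) * t ^ j * (1 - t) ^ (n - j))"
      by simp
  qed
  finally show ?thesis .
qed

section \<open>Binomial tails and moments of uniform order statistics\<close>

text \<open>A Beta integral: under a uniform success probability, every number of successes among \<open>n\<close>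
  trials is equally likely.\<close>

lemma has_integral_binomial_term:
  assumes "j \<le> n"
  shows "((\<lambda>t::real. real (n choose j) * t ^ j * (1 - t) ^ (n - j)) has_integral 1 / real (n + 1)) {0..1}"
proof -
  have "((\<lambda>t::real. t powr (real (j + 1) - 1) * (1 - t) powr (real (n - j + 1) - 1)) has_integral
      Beta (real (j + 1)) (real (n - j + 1))) {0..1}"
    by (rule has_integral_Beta_real) auto
  \<comment> \<open>at the end points \<open>0 powr 0 = 0\<close>, but \<open>0 ^ 0 = 1\<close>\<close>
  moreover have "t powr (real (j + 1) - 1) * (1 - t) powr (real (n - j + 1) - 1) = t ^ j * (1 - t) ^ (n - j)"
    if "t \<in> {0..1} - {0, 1}" for t :: real
    using that by (simp add: powr_realpow)
  ultimately have "((\<lambda>t::real. t ^ j * (1 - t) ^ (n - j)) has_integral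
      Beta (real (j + 1)) (real (n - j + 1))) {0..1}"
    by (subst has_integral_spike_finite_eq[of "{0, 1}"]) auto
  then have "((\<lambda>t::real. real (n choose j) * (t ^ j * (1 - t) ^ (n - j))) has_integral
      real (n choose j) * Beta (real (j + 1)) (real (n - j + 1))) {0..1}"
    by (rule has_integral_mult_right)
  moreover have "Beta (real (j + 1)) (real (n - j + 1)) = fact j * fact (n - j) / fact (n + 1)"
    using Gamma_fact[of j, where 'a = real] Gamma_fact[of "n - j", where 'a = real]
      Gamma_fact[of "n + 1", where 'a = real] assms
    by (simp add: Beta_def of_nat_diff add_ac)
  moreover have "real (n choose j) * (fact j * fact (n - j) / fact (n + 1)) = 1 / real (n + 1)"
  proof -
    have "real (n choose j) * (fact j * fact (n - j)) = fact n"
      using assms by (simp add: binomial_fact)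
    then have "real (n choose j) * (fact j * fact (n - j) / fact (n + 1)) = fact n / fact (n + 1)"
      by (simp only: times_divide_eq_right)
    also have "\<dots> = 1 / real (n + 1)" by simp
    finally show ?thesis .
  qed
  ultimately show ?thesis by (simp add: mult.assoc)
qed

text \<open>The factor \<open>t\<close> is absorbed into a binomial term of order \<open>n + 1\<close>.\<close>

lemma has_integral_binomial_term_moment:
  assumes "j \<le> n"
  shows "((\<lambda>t::real. t * (real (n choose j) * t ^ j * (1 - t) ^ (n - j))) has_integral
    real (j + 1) / (real (n + 1) * real (n + 2))) {0..1}"
proof -
  have "real (j + 1) * real (Suc n choose Suc j) = real (n + 1) * real (n choose j)"
    using Suc_times_binomial_eq[of n j] by (metis Suc_eq_plus1 mult.commute of_nat_mult)
  then have c: "real (n choose j) = real (j + 1) / real (n + 1) * real (Suc n choose Suc j)"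
    by (simp add: field_simps)
  have "((\<lambda>t::real. real (j + 1) / real (n + 1) * (real (Suc n choose Suc j) * t ^ Suc j * (1 - t) ^ (Suc n - Suc j)))
      has_integral real (j + 1) / real (n + 1) * (1 / real (Suc n + 1))) {0..1}"
    using assms by (intro has_integral_mult_right has_integral_binomial_term) simp
  then show ?thesis
    unfolding c by (simp add: mult_ac)
qed

text \<open>The expectation of \<open>1 / (N + 1)\<close> for a binomial variable \<open>N\<close>: dividing by \<open>n + 1\<close> turns each term
  into one of the binomial expansion of order \<open>m + 1\<close>, of which only the term at \<open>0\<close> is absent.\<close>

lemma sum_binomial_pmf_inverse_Suc:
  fixes p :: real
  assumes "p \<noteq> 0"
  shows "(\<Sum>n\<le>m. real (m choose n) * p ^ n * (1 - p) ^ (m - n) * (1 / real (n + 1))) =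
    (1 - (1 - p) ^ (m + 1)) / (p * real (m + 1))"
proof -
  have "real (m + 1) * p * (real (m choose n) * p ^ n * (1 - p) ^ (m - n) * (1 / real (n + 1))) =
      real (Suc m choose Suc n) * p ^ Suc n * (1 - p) ^ (Suc m - Suc n)" for n
  proof -
    have "real (n + 1) * real (Suc m choose Suc n) = real (m + 1) * real (m choose n)"
      using Suc_times_binomial_eq[of m n] by (metis Suc_eq_plus1 mult.commute of_nat_mult)
    then have c: "real (Suc m choose Suc n) = real (m + 1) * real (m choose n) / real (n + 1)"
      by (simp add: field_simps)
    show ?thesis unfolding c by simp
  qed
  then have "real (m + 1) * p * (\<Sum>n\<le>m. real (m choose n) * p ^ n * (1 - p) ^ (m - n) * (1 / real (n + 1))) =
      (\<Sum>n\<le>m. real (Suc m choose Suc n) * p ^ Suc n * (1 - p) ^ (Suc m - Suc n))"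
    by (simp only: sum_distrib_left)
  also have "\<dots> = (\<Sum>n\<le>Suc m. real (Suc m choose n) * p ^ n * (1 - p) ^ (Suc m - n)) - (1 - p) ^ (m + 1)"
    by (subst sum.atMost_Suc_shift) simp
  also have "\<dots> = 1 - (1 - p) ^ (m + 1)"
    by (subst binomial_ring[symmetric]) simp
  finally have "real (m + 1) * p * (\<Sum>n\<le>m. real (m choose n) * p ^ n * (1 - p) ^ (m - n) * (1 / real (n + 1))) =
      1 - (1 - p) ^ (m + 1)" .
  then show ?thesis using assms by (simp only: eq_divide_eq) (simp add: mult_ac)
qed

text \<open>For \<open>0 < k \<le> n\<close> the left-hand side is the second moment around \<open>a\<close> of the
  \<open>k\<close>-th order statistic of \<open>n\<close> uniform variables, a Beta variable with mean \<open>b = k / (n + 1)\<close>: its variance is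
  \<open>b (1 - b) / (n + 2)\<close>, and its squared bias is at most \<open>1 / (n + 1)\<^sup>2\<close> because \<open>k\<close> is \<open>a (n + 1)\<close>
  rounded up. For \<open>k = n + 1\<close> it is the value \<open>(1 - a)\<^sup>2\<close> that belongs to an infinite threshold.\<close>

lemma order_statistic_second_moment_le:
  fixes a :: real and n k :: nat
  assumes "a * real (n + 1) \<le> real k" "real k < a * real (n + 1) + 1"
  shows "a\<^sup>2 + (\<Sum>j<k. 2 * (real (j + 1) / (real (n + 1) * real (n + 2))) - 2 * a * (1 / real (n + 1)))
    \<le> 9 / 4 * (1 / real (n + 1))"
proof -
  define N where "N = real (n + 1)"
  have N: "1 \<le> N" "real (n + 2) = N + 1" by (auto simp: N_def)
  define b where "b = real k / N"
  have k: "real k = b * N" using N by (simp add: b_def)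
  have g: "2 * (\<Sum>j<k. real (j + 1)) = real k * (real k + 1)"
    by (induction k) (simp_all add: algebra_simps)
  have "(\<Sum>j<k. 2 * (real (j + 1) / (N * (N + 1))) - 2 * a * (1 / N)) =
      2 * (\<Sum>j<k. real (j + 1)) / (N * (N + 1)) - 2 * a * real k / N"
    by (simp only: sum_subtractf sum_distrib_left sum_divide_distrib) simp
  also have "\<dots> = real k * (real k + 1) / (N * (N + 1)) - 2 * a * real k / N"
    by (simp only: g)
  also have "\<dots> = b * (b * N + 1) / (N + 1) - 2 * a * b"
    using N unfolding k by (simp add: divide_simps)
  finally have S: "a\<^sup>2 + (\<Sum>j<k. 2 * (real (j + 1) / (N * (N + 1))) - 2 * a * (1 / N)) =
      (b - a)\<^sup>2 + b * (1 - b) / (N + 1)"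
    using N by (simp add: field_simps power2_eq_square)
  have "0 \<le> b - a" "b - a \<le> 1 / N"
  proof -
    have ba: "b - a = (real k - a * N) / N" using N by (simp add: b_def diff_divide_distrib)
    show "0 \<le> b - a" unfolding ba using assms N unfolding N_def[symmetric] by simp
    show "b - a \<le> 1 / N"
      unfolding ba using assms N unfolding N_def[symmetric] by (intro divide_right_mono) auto
  qed
  then have "(b - a)\<^sup>2 \<le> (1 / N)\<^sup>2" by (intro power_mono)
  also have "\<dots> \<le> 1 / N" using N by (simp add: power2_eq_square field_simps)
  finally have 1: "(b - a)\<^sup>2 \<le> 1 / N" .
  have "b * (1 - b) \<le> 1" using zero_le_power2[of "b - 1/2"] by (simp add: power2_eq_square field_simps)
  then have "b * (1 - b) / (N + 1) \<le> 1 / (N + 1)" using N by (intro divide_right_mono) auto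
  also have "\<dots> \<le> 5 / 4 * (1 / N)" using N by (simp add: field_simps)
  finally show ?thesis using 1 S unfolding N_def[symmetric] N(2) by simp
qed

text \<open>Integrate \<open>(V - a)\<^sup>2 - a\<^sup>2 = \<integral> 2 (t - a) dt\<close> over \<open>0 < t < V\<close> and exchange the integrals. Tail
  probabilities are thus all that has to be known of \<open>V\<close>.\<close>

lemma (in prob_space) second_moment_layer_cake:
  fixes V :: "'a \<Rightarrow> real"
  assumes [measurable]: "V \<in> borel_measurable M" and V: "\<And>x. x \<in> space M \<Longrightarrow> 0 \<le> V x \<and> V x \<le> 1"
    and H: "\<And>t. 0 < t \<Longrightarrow> t < 1 \<Longrightarrow> prob {x \<in> space M. t < V x} = H t"
    and I: "((\<lambda>t. 2 * (t - a) * H t) has_integral I) {0..1}"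
  shows "expectation (\<lambda>x. (V x - a)\<^sup>2) = a\<^sup>2 + I"
proof -
  define L where "L = restrict_space lborel {0..1::real}"
  have fL: "finite_measure L"
    unfolding L_def by (rule finite_measureI) (simp add: emeasure_restrict_space space_restrict_space)
  interpret L: finite_measure L by fact
  interpret pair_sigma_finite L M ..
  interpret LM: finite_measure "L \<Otimes>\<^sub>M M"
    by (intro finite_measure_pair_measure fL) unfold_locales
  have [measurable_cong]: "sets L = sets (restrict_space borel {0..1})"
    unfolding L_def by (rule sets_restrict_space_cong) simp
  have id: "(\<lambda>t. t) \<in> borel_measurable L"
    unfolding L_def by (intro measurable_restrict_space1) simp
  have spL: "space L = {0..1}" by (simp add: L_def space_restrict_space)
  let ?f = "\<lambda>t x. 2 * (t - a) * indicator {..<V x} t"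
  have int: "integrable (L \<Otimes>\<^sub>M M) (case_prod ?f)"
  proof (rule LM.integrable_const_bound[where B = "2 * (1 + \<bar>a\<bar>)"])
    show "case_prod ?f \<in> borel_measurable (L \<Otimes>\<^sub>M M)"
    proof -
      note id[measurable]
      show ?thesis unfolding indicator_def lessThan_iff by measurable
    qed
    show "AE z in L \<Otimes>\<^sub>M M. norm (case_prod ?f z) \<le> 2 * (1 + \<bar>a\<bar>)"
      by (rule AE_I2) (auto simp: space_pair_measure spL indicator_def abs_mult)
  qed
  have inner1: "(\<integral>t. ?f t x \<partial>L) = (V x - a)\<^sup>2 - a\<^sup>2" if x: "x \<in> space M" for x
  proof -
    have "(\<integral>t. 2 * (t - a) * indicator {0..V x} t \<partial>lborel) = (V x - a)\<^sup>2 - (0 - a)\<^sup>2"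
      using V[OF x] by (intro integral_FTC_Icc_real) (auto intro!: derivative_eq_intros simp: power2_eq_square algebra_simps)
    moreover have "(\<integral>t. ?f t x \<partial>L) = (\<integral>t. indicator {0..1} t *\<^sub>R ?f t x \<partial>lborel)"
      unfolding L_def by (intro integral_restrict_space) simp
    moreover have "\<dots> = (\<integral>t. 2 * (t - a) * indicator {0..V x} t \<partial>lborel)"
    proof (rule integral_cong_AE)
      show "AE t in lborel. indicator {0..1} t *\<^sub>R ?f t x = 2 * (t - a) * indicator {0..V x} t"
        using AE_lborel_singleton[of "V x"] by eventually_elim (use V[OF x] in \<open>auto simp: indicator_def\<close>)
    qed measurable
    ultimately show ?thesis by simp
  qed
  have inner2: "(\<integral>x. ?f t x \<partial>M) = 2 * (t - a) * H t" if t: "0 < t" "t < 1" for t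
  proof -
    have "(\<integral>x. indicator {..<V x} t \<partial>M) = prob {x \<in> space M. t < V x}"
      by (subst Bochner_Integration.integral_cong[where g = "indicator {x \<in> space M. t < V x}", OF refl])
         (auto simp: indicator_def)
    then show ?thesis by (simp add: H[OF t])
  qed
  have "expectation (\<lambda>x. (V x - a)\<^sup>2) - a\<^sup>2 = expectation (\<lambda>x. (V x - a)\<^sup>2 - a\<^sup>2)"
  proof -
    have "\<bar>V x - a\<bar> \<le> 1 + \<bar>a\<bar>" if "x \<in> space M" for x using V[OF that] by auto
    then have "(V x - a)\<^sup>2 \<le> (1 + \<bar>a\<bar>)\<^sup>2" if "x \<in> space M" for x
      using that by (metis abs_ge_zero power2_abs power_mono)
    then have "integrable M (\<lambda>x. (V x - a)\<^sup>2)"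
      by (intro integrable_const_bound[where B = "(1 + \<bar>a\<bar>)\<^sup>2"] AE_I2) auto
    then show ?thesis by (simp add: prob_space)
  qed
  also have "\<dots> = (\<integral>x. (\<integral>t. ?f t x \<partial>L) \<partial>M)"
    using inner1 by (intro Bochner_Integration.integral_cong) auto
  also have "\<dots> = (\<integral>t. (\<integral>x. ?f t x \<partial>M) \<partial>L)"
    by (rule Fubini_integral[OF int])
  also have "\<dots> = I"
  proof -
    let ?g = "\<lambda>t. \<integral>x. ?f t x \<partial>M"
    have "integrable L ?g" using integrable_fst[OF int] by simp
    then have "set_integrable lborel {0..1} ?g"
      unfolding L_def set_integrable_def by (subst (asm) integrable_restrict_space) auto
    then have "(LINT t:{0..1}|lborel. ?g t) = integral {0..1} ?g"
      by (rule set_borel_integral_eq_integral)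
    moreover have "(\<integral>t. ?g t \<partial>L) = (LINT t:{0..1}|lborel. ?g t)"
      unfolding L_def set_lebesgue_integral_def by (intro integral_restrict_space) simp
    moreover have "(?g has_integral I) {0..1}"
      using inner2 by (intro has_integral_spike_finite[OF _ _ I, of "{0, 1}"]) auto
    ultimately show ?thesis by (simp only: integral_unique)
  qed
  finally show ?thesis by simp
qed

text \<open>Jensen's inequality, in the form that the variance of \<open>\<bar>X\<bar>\<close> is nonnegative.\<close>

lemma expectation_abs_le_sqrt_second_moment:
  fixes X :: "'a \<Rightarrow> real"
  assumes "prob_space M" "integrable M X" "integrable M (\<lambda>x. (X x)\<^sup>2)"
  shows "(\<integral>x. \<bar>X x\<bar> \<partial>M) \<le> sqrt (\<integral>x. (X x)\<^sup>2 \<partial>M)"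
proof -
  interpret prob_space M by fact
  have "0 \<le> variance (\<lambda>x. \<bar>X x\<bar>)" by (rule variance_positive)
  also have "\<dots> = (\<integral>x. (X x)\<^sup>2 \<partial>M) - (\<integral>x. \<bar>X x\<bar> \<partial>M)\<^sup>2"
    using assms by (subst variance_eq) auto
  finally show ?thesis by (intro real_le_rsqrt) simp
qed

section \<open>The law of the observations and admissible kernels\<close>

lemma
  assumes P: "prob_space P" and K: "K \<in> P \<rightarrow>\<^sub>M prob_algebra borel"
  shows sets_joint_law: "sets (joint_law P K) = sets (P \<Otimes>\<^sub>M borel)"
    and prob_space_joint_law: "prob_space (joint_law P K)"
    and emeasure_joint_law_times: "A \<in> sets P \<Longrightarrow> B \<in> sets borel \<Longrightarrow>
      emeasure (joint_law P K) (A \<times> B) = (\<integral>\<^sup>+x. emeasure (K x) B * indicator A x \<partial>P)"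
proof -
  interpret prob_space P by fact
  have K'[measurable]: "K \<in> P \<rightarrow>\<^sub>M subprob_algebra borel" by (rule measurable_prob_algebraD[OF K])
  have Kp: "prob_space (K x)" and Ks: "sets (K x) = sets borel" if "x \<in> space P" for x
    using measurable_space[OF K that] by (auto simp: space_prob_algebra)
  let ?k = "\<lambda>x. K x \<bind> (\<lambda>y. return (P \<Otimes>\<^sub>M borel) (x, y))"
  have k[measurable]: "?k \<in> P \<rightarrow>\<^sub>M subprob_algebra (P \<Otimes>\<^sub>M borel)"
    by measurable
  have ret: "(\<lambda>y. return (P \<Otimes>\<^sub>M borel) (x, y)) \<in> K x \<rightarrow>\<^sub>M subprob_algebra (P \<Otimes>\<^sub>M borel)"
    if "x \<in> space P" for x
    using that by (subst measurable_cong_sets[OF Ks[OF that] refl]) measurable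
  show "sets (joint_law P K) = sets (P \<Otimes>\<^sub>M borel)"
    unfolding joint_law_def by (rule sets_bind[OF sets_kernel[OF k] not_empty])
  show "prob_space (joint_law P K)"
    unfolding joint_law_def
  proof (rule prob_space_bind[OF _ k], rule AE_I2)
    fix x assume x: "x \<in> space P"
    interpret Kx: prob_space "K x" by (rule Kp[OF x])
    show "prob_space (?k x)"
      using x sets_eq_imp_space_eq[OF Ks[OF x]]
      by (intro Kx.prob_space_bind[OF _ ret[OF x]] AE_I2 prob_space_return) (auto simp: space_pair_measure)
  qed
  assume [measurable]: "A \<in> sets P" "B \<in> sets borel"
  have "emeasure (joint_law P K) (A \<times> B) = (\<integral>\<^sup>+x. emeasure (?k x) (A \<times> B) \<partial>P)"
    unfolding joint_law_def by (rule emeasure_bind[OF not_empty k]) simp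
  also have "\<dots> = (\<integral>\<^sup>+x. emeasure (K x) B * indicator A x \<partial>P)"
  proof (rule nn_integral_cong)
    fix x assume x: "x \<in> space P"
    interpret Kx: prob_space "K x" by (rule Kp[OF x])
    have "emeasure (?k x) (A \<times> B) = (\<integral>\<^sup>+y. emeasure (return (P \<Otimes>\<^sub>M borel) (x, y)) (A \<times> B) \<partial>K x)"
      by (rule emeasure_bind[OF Kx.not_empty ret[OF x]]) simp
    also have "\<dots> = (\<integral>\<^sup>+y. indicator A x * indicator B y \<partial>K x)"
      by (intro nn_integral_cong) (auto simp: indicator_def)
    also have "\<dots> = emeasure (K x) B * indicator A x"
      by (simp add: nn_integral_cmult_indicator Ks[OF x] mult.commute)
    finally show "emeasure (?k x) (A \<times> B) = emeasure (K x) B * indicator A x" .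
  qed
  finally show "emeasure (joint_law P K) (A \<times> B) = (\<integral>\<^sup>+x. emeasure (K x) B * indicator A x \<partial>P)" .
qed

lemma measure_joint_law_singleton_times:
  assumes P: "prob_space P" and K: "K \<in> P \<rightarrow>\<^sub>M prob_algebra borel"
    and "{x} \<in> sets P" "x \<in> space P" "B \<in> sets borel"
  shows "measure (joint_law P K) ({x} \<times> B) = measure P {x} * measure (K x) B"
proof -
  interpret prob_space P by fact
  interpret Kx: prob_space "K x" using measurable_space[OF K assms(4)] by (auto simp: space_prob_algebra)
  interpret J: prob_space "joint_law P K" by (rule prob_space_joint_law[OF P K])
  show ?thesis
    using emeasure_joint_law_times[OF P K assms(3,5)] assms(3)
    by (simp add: nn_integral_indicator_singleton emeasure_eq_measure Kx.emeasure_eq_measure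
        J.emeasure_eq_measure mult.commute flip: ennreal_mult)
qed

text \<open>The exceptional set in the definition of admissibility is a null set, so it cannot contain an atom
  of the covariate distribution. There the density bound, applied to degenerate intervals, excludes
  atoms of the conditional law.\<close>

lemma admissible_kernel_no_atoms:
  assumes "K \<in> admissible_kernels \<alpha> P" and P: "prob_space P" and x: "{x} \<in> sets P" "measure P {x} \<noteq> 0"
  shows "measure (K x) {y} = 0"
proof -
  interpret prob_space P by fact
  from assms(1) obtain X\<^sub>0 \<mu> where X0: "X\<^sub>0 \<in> sets P" "emeasure P X\<^sub>0 = 1"
    and \<mu>: "\<And>x u v. x \<in> X\<^sub>0 \<Longrightarrow> u \<le> v \<Longrightarrow> measure (K x) {u..v} \<le> \<mu> * (v - u)"
    unfolding admissible_kernels_def by blast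
  have "x \<in> X\<^sub>0"
  proof (rule ccontr)
    assume "x \<notin> X\<^sub>0"
    then have "measure P (X\<^sub>0 \<union> {x}) = measure P X\<^sub>0 + measure P {x}"
      using X0 x by (intro finite_measure_Union) auto
    moreover have "measure P X\<^sub>0 = 1" using X0 by (simp add: measure_def)
    moreover have "measure P (X\<^sub>0 \<union> {x}) \<le> 1" by (rule prob_le_1)
    ultimately show False using x(2) measure_nonneg[of P "{x}"] by linarith
  qed
  from \<mu>[OF this, of y y] measure_nonneg[of "K x" "{y}"] show ?thesis by simp
qed

text \<open>With respect to a point mass all \<open>L\<^sup>p\<close> norms are the absolute value at the point.\<close>

lemma Lp_norm_return:
  assumes [measurable]: "f \<in> borel_measurable M" and "x \<in> space M" and "1 \<le> p"
  shows "Lp_norm p (return M x) f = ennreal \<bar>f x\<bar>"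
proof (cases "p = \<infinity>")
  case True
  have "esssup (return M x) (\<lambda>x. ennreal \<bar>f x\<bar>) = ennreal \<bar>f x\<bar>"
  proof (rule antisym)
    show "esssup (return M x) (\<lambda>x. ennreal \<bar>f x\<bar>) \<le> ennreal \<bar>f x\<bar>"
      using assms by (intro esssup_I) (auto simp: AE_return)
    have "AE y in return M x. ennreal \<bar>f y\<bar> \<le> esssup (return M x) (\<lambda>x. ennreal \<bar>f x\<bar>)"
      by (rule esssup_AE)
    then show "ennreal \<bar>f x\<bar> \<le> esssup (return M x) (\<lambda>x. ennreal \<bar>f x\<bar>)"
      using assms by (subst (asm) AE_return) auto
  qed
  then show ?thesis using True by (simp add: Lp_norm_def)
next
  case False
  then have "1 \<le> enn2real p"
    using assms(3) enn2real_mono[of 1 p] by (simp add: less_top)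
  moreover have "(\<integral>\<^sup>+y. ennreal (\<bar>f y\<bar> powr enn2real p) \<partial>return M x) = ennreal (\<bar>f x\<bar> powr enn2real p)"
    using assms by (subst nn_integral_return) auto
  ultimately show ?thesis
    using False by (simp add: Lp_norm_def powr_powr)
qed

section \<open>Coverage error at the target point\<close>

text \<open>The coverage \<open>V\<close> at \<open>x\<^sub>0\<close> exceeds \<open>t\<close> precisely if fewer than
  \<open>a (N + 1)\<close> of the \<open>N\<close> calibration points at \<open>x\<^sub>0\<close> have a score up to the \<open>t\<close>-quantile. The pair of
  counts has an explicit law, hence so has the second moment of \<open>V - a\<close>: it is the binomial average
  over \<open>N\<close> of the second moments of order statistics. The latter are at most \<open>9 / (4 (N + 1))\<close>,
  whose average is available in closed form, and Jensen's inequality is applied once to the whole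
  average.\<close>

lemma expected_coverage_error_le:
  fixes P :: "'a measure" and S :: "'a \<Rightarrow> real \<Rightarrow> real" and p :: real
  assumes P: "prob_space P" and K: "K \<in> P \<rightarrow>\<^sub>M prob_algebra borel"
    and x0: "{x\<^sub>0} \<in> sets P" "measure P {x\<^sub>0} = p" and xD: "{x\<^sub>D} \<in> sets P" "measure P {x\<^sub>D} = 1 - p"
    and "x\<^sub>0 \<noteq> x\<^sub>D" "0 < p"
    and w: "w \<in> borel_measurable P" "\<And>x. 0 \<le> w x" "0 < w x\<^sub>0" "w x\<^sub>D = 0"
    and S: "(\<lambda>z. S (fst z) (snd z)) \<in> borel_measurable (P \<Otimes>\<^sub>M borel)"
    and noatom: "\<And>s. measure (K x\<^sub>0) {y. S x\<^sub>0 y = s} = 0"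
    and s1: "measure (K x\<^sub>0) {y. S x\<^sub>0 y \<le> s\<^sub>1} = 0"
    and \<alpha>: "0 < \<alpha>" "\<alpha> < 1"
  shows "(\<integral>\<^sup>+D. ennreal \<bar>coverage K S (weighted_conformal_threshold \<alpha> w S x\<^sub>0 m D) x\<^sub>0 - (1 - \<alpha>)\<bar>
      \<partial>calibration_law m P K) \<le> ennreal (3 / 2 * sqrt ((1 - (1 - p) ^ (m + 1)) / (p * real (m + 1))))"
proof -
  interpret P: prob_space P by fact
  define N where "N = joint_law P K"
  interpret N: prob_space N unfolding N_def by (rule prob_space_joint_law[OF P K])
  define \<Omega> where "\<Omega> = Pi\<^sub>M {..<m} (\<lambda>_. N)"
  interpret \<Omega>: prob_space \<Omega> unfolding \<Omega>_def by (intro prob_space_PiM N.prob_space_axioms)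
  have setsN: "sets N = sets (P \<Otimes>\<^sub>M borel)" unfolding N_def by (rule sets_joint_law[OF P K])
  have sp: "x\<^sub>0 \<in> space P" "x\<^sub>D \<in> space P" using x0(1) xD(1) sets.sets_into_space by blast+
  interpret K0: prob_space "K x\<^sub>0"
    using measurable_space[OF K sp(1)] by (auto simp: space_prob_algebra)
  have setsK: "sets (K x\<^sub>0) = sets borel"
    using measurable_space[OF K sp(1)] by (auto simp: space_prob_algebra)
  have spK: "space (K x\<^sub>0) = UNIV" using sets_eq_imp_space_eq[OF setsK] by simp
  have "p \<le> 1" using x0(2) P.prob_le_1 by auto
  have g[measurable]: "S x\<^sub>0 \<in> borel_measurable borel"
    using measurable_compose[OF measurable_Pair1'[OF sp(1)] S] by simp
  define a where "a = 1 - \<alpha>"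
  have a: "0 < a" "a < 1" using \<alpha> by (auto simp: a_def)
  define q where "q D = weighted_conformal_threshold \<alpha> w S x\<^sub>0 m D" for D
  define V where "V D = measure (K x\<^sub>0) {y. ereal (S x\<^sub>0 y) \<le> q D}" for D
  have V01: "0 \<le> V D \<and> V D \<le> 1" for D by (simp add: V_def)
  have quantile: "\<exists>s. measure (K x\<^sub>0) {y. S x\<^sub>0 y \<le> s} = t \<and>
      (\<forall>D. t < V D \<longleftrightarrow> \<not> a \<le> weighted_score_cdf w S x\<^sub>0 m D (ereal s))"
    if t: "0 \<le> t" "t < 1" for t
  proof -
    obtain s where s: "measure (K x\<^sub>0) {y. S x\<^sub>0 y \<le> s} = t"
      "\<And>q. t < measure (K x\<^sub>0) {y. ereal (S x\<^sub>0 y) \<le> q} \<longleftrightarrow> ereal s < q"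
      using continuous_score_quantile[OF K0.prob_space_axioms setsK g noatom t, of s\<^sub>1] s1 t(1) by auto
    have "t < V D \<longleftrightarrow> \<not> a \<le> weighted_score_cdf w S x\<^sub>0 m D (ereal s)" for D
      unfolding V_def s(2) q_def a_def
      by (simp add: weighted_conformal_threshold_le_iff[OF w(2) \<alpha>(2), symmetric] not_le)
    with s(1) show ?thesis by blast
  qed
  have V_meas: "V \<in> borel_measurable \<Omega>"
    unfolding borel_measurable_iff_greater
  proof
    fix t :: real
    consider "t < 0" | "0 \<le> t" "t < 1" | "1 \<le> t" by linarith
    then show "{D \<in> space \<Omega>. t < V D} \<in> sets \<Omega>"
    proof cases
      case 1
      have "t < V D" for D using 1 V01[of D] by simp
      then show ?thesis by simp
    next
      case 2
      then obtain s where s: "\<And>D. t < V D \<longleftrightarrow> \<not> a \<le> weighted_score_cdf w S x\<^sub>0 m D (ereal s)"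
        using quantile by blast
      have [measurable]: "(\<lambda>D. weighted_score_cdf w S x\<^sub>0 m D (ereal s)) \<in> borel_measurable \<Omega>"
        unfolding \<Omega>_def by (rule borel_measurable_weighted_score_cdf[OF w(1) S setsN])
      show ?thesis unfolding s by measurable
    next
      case 3
      have "\<not> t < V D" for D using 3 V01[of D] by simp
      then show ?thesis by simp
    qed
  qed
  \<comment> \<open>the values of \<open>w\<close> are known only at the two atoms, so the reduction to counts holds almost
    surely\<close>
  have AE_support: "AE D in \<Omega>. \<forall>i\<in>{..<m}. fst (D i) \<in> {x\<^sub>0, x\<^sub>D}"
  proof -
    have "measure N ({x\<^sub>0} \<times> UNIV \<union> {x\<^sub>D} \<times> UNIV) = measure N ({x\<^sub>0} \<times> UNIV) + measure N ({x\<^sub>D} \<times> UNIV)"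
      using x0(1) xD(1) \<open>x\<^sub>0 \<noteq> x\<^sub>D\<close> by (intro N.finite_measure_Union) (auto simp: setsN)
    also have "\<dots> = 1"
    proof -
      interpret KD: prob_space "K x\<^sub>D" using measurable_space[OF K sp(2)] by (auto simp: space_prob_algebra)
      have "sets (K x\<^sub>D) = sets borel" using measurable_space[OF K sp(2)] by (auto simp: space_prob_algebra)
      then have "space (K x\<^sub>D) = UNIV" using sets_eq_imp_space_eq[of "K x\<^sub>D" borel] by simp
      then show ?thesis
        using measure_joint_law_singleton_times[OF P K x0(1) sp(1), of UNIV] x0(2) spK K0.prob_space
          measure_joint_law_singleton_times[OF P K xD(1) sp(2), of UNIV] xD(2) KD.prob_space
        by (simp add: N_def)
    qed
    finally have "AE z in N. z \<in> {x\<^sub>0} \<times> UNIV \<union> {x\<^sub>D} \<times> UNIV"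
      using x0(1) xD(1) by (subst N.prob_eq_1[symmetric]) (auto simp: setsN)
    then have N: "AE z in N. fst z \<in> {x\<^sub>0, x\<^sub>D}" by (rule AE_mp) (auto intro!: AE_I2)
    show ?thesis
      unfolding \<Omega>_def
      by (intro AE_finite_allI AE_PiM_component N finite_lessThan N.prob_space_axioms)
  qed
  \<comment> \<open>rank of the calibration score that serves as threshold; \<open>k n = n + 1\<close> stands for an
    infinite threshold, where the tail sum is the full binomial sum\<close>
  define k where "k n = nat \<lceil>a * real (n + 1)\<rceil>" for n
  have k: "a * real (n + 1) \<le> real (k n)" "real (k n) < a * real (n + 1) + 1" for n
    using a by (auto simp: k_def) linarith+
  have k_set: "{j. j \<le> n \<and> \<not> a \<le> real j / real (n + 1)} = {..<k n}" for n
  proof -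
    have less: "real j < a * real (n + 1) \<longleftrightarrow> j < k n" for j
      unfolding k_def by (simp add: zless_nat_eq_int_zless less_ceiling_iff)
    have "a * real (n + 1) < real (n + 1)" using a by simp
    then have "j \<le> n" if "j < k n" for j using that less[of j] by linarith
    then show ?thesis using less by (auto simp: not_le field_simps)
  qed
  \<comment> \<open>probability of \<open>n\<close> calibration points at \<open>x\<^sub>0\<close>\<close>
  define c where "c n = real (m choose n) * p ^ n * (1 - p) ^ (m - n)" for n
  have c0: "0 \<le> c n" for n using \<open>0 < p\<close> \<open>p \<le> 1\<close> by (simp add: c_def)
  have c1: "(\<Sum>n\<le>m. c n) = 1" unfolding c_def by (subst binomial_ring[symmetric]) simp
  define H where "H t = (\<Sum>n\<le>m. c n * (\<Sum>j<k n. real (n choose j) * t ^ j * (1 - t) ^ (n - j)))" for t :: real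
  have prob_V: "\<Omega>.prob {D \<in> space \<Omega>. t < V D} = H t" if t: "0 < t" "t < 1" for t
  proof -
    obtain s where s: "measure (K x\<^sub>0) {y. S x\<^sub>0 y \<le> s} = t"
      "\<And>D. t < V D \<longleftrightarrow> \<not> a \<le> weighted_score_cdf w S x\<^sub>0 m D (ereal s)"
      using quantile[of t] t by auto
    let ?A = "{x\<^sub>0} \<times> {y. S x\<^sub>0 y \<le> s}" and ?B = "{x\<^sub>0} \<times> (UNIV :: real set)"
    have AB: "?A \<in> sets N" "?B \<in> sets N" using x0(1) by (auto simp: setsN)
    have mAB: "measure N ?A = p * t" "measure N ?B = p"
      unfolding N_def using x0(2) s(1) K0.prob_space spK
      by (subst measure_joint_law_singleton_times[OF P K x0(1) sp(1)]; simp)+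
    let ?R = "\<lambda>n j. \<not> a \<le> real j / real (n + 1)"
    let ?E = "{D \<in> space \<Omega>. ?R (card {i. i < m \<and> D i \<in> ?B}) (card {i. i < m \<and> D i \<in> ?A})}"
    have "\<Omega>.prob {D \<in> space \<Omega>. t < V D} = \<Omega>.prob ?E"
    proof (rule \<Omega>.finite_measure_eq_AE)
      show "AE D in \<Omega>. (D \<in> {D \<in> space \<Omega>. t < V D}) = (D \<in> ?E)"
        using AE_support
      proof eventually_elim
        case (elim D)
        have "weighted_score_cdf w S x\<^sub>0 m D (ereal s) =
            real (card {i. i < m \<and> D i \<in> ?A}) / real (card {i. i < m \<and> D i \<in> ?B} + 1)"
          using elim by (intro weighted_score_cdf_two_point[where x\<^sub>D = x\<^sub>D] w) auto
        then show ?case by (simp only: mem_Collect_eq s(2))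
      qed
      show "{D \<in> space \<Omega>. t < V D} \<in> sets \<Omega>"
        using V_meas by measurable
      have [measurable]: "?A \<in> sets N" "?B \<in> sets N" by (fact AB)+
      show "?E \<in> sets \<Omega>"
        unfolding \<Omega>_def by measurable
    qed
    also have "\<dots> = (\<Sum>n\<le>m. real (m choose n) * p ^ n * (1 - p) ^ (m - n) *
      (\<Sum>j | j \<le> n \<and> ?R n j. real (n choose j) * t ^ j * (1 - t) ^ (n - j)))"
      unfolding \<Omega>_def by (rule measure_PiM_nested_counts[OF N.prob_space_axioms AB _ mAB]) auto
    also have "\<dots> = H t"
      unfolding H_def c_def k_set ..
    finally show ?thesis .
  qed
  define e where "e n j = 2 * (real (j + 1) / (real (n + 1) * real (n + 2))) - 2 * a * (1 / real (n + 1))"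
    for n j :: nat
  have "((\<lambda>t. 2 * (t - a) * H t) has_integral (\<Sum>n\<le>m. c n * (\<Sum>j<k n. e n j))) {0..1}"
  proof -
    have term_integral: "((\<lambda>t::real. 2 * (t * (real (n choose j) * t ^ j * (1 - t) ^ (n - j))) -
        2 * a * (real (n choose j) * t ^ j * (1 - t) ^ (n - j))) has_integral e n j) {0..1}" if "j < k n" for n j
    proof -
      have "j \<le> n" using that k_set[of n] by blast
      then show ?thesis unfolding e_def
        by (intro has_integral_diff has_integral_mult_right has_integral_binomial_term
            has_integral_binomial_term_moment)
    qed
    have "((\<lambda>t. \<Sum>n\<le>m. c n * (\<Sum>j<k n. 2 * (t * (real (n choose j) * t ^ j * (1 - t) ^ (n - j))) -
        2 * a * (real (n choose j) * t ^ j * (1 - t) ^ (n - j)))) has_integral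
        (\<Sum>n\<le>m. c n * (\<Sum>j<k n. e n j))) {0..1}"
      by (intro has_integral_sum has_integral_mult_right term_integral) auto
    moreover have "(\<Sum>n\<le>m. c n * (\<Sum>j<k n. 2 * (t * (real (n choose j) * t ^ j * (1 - t) ^ (n - j))) -
        2 * a * (real (n choose j) * t ^ j * (1 - t) ^ (n - j)))) = 2 * (t - a) * H t" for t
      unfolding H_def sum_distrib_left by (intro sum.cong refl) (simp add: algebra_simps)
    ultimately show ?thesis by simp
  qed
  then have "\<Omega>.expectation (\<lambda>D. (V D - a)\<^sup>2) = a\<^sup>2 + (\<Sum>n\<le>m. c n * (\<Sum>j<k n. e n j))"
    by (intro \<Omega>.second_moment_layer_cake[where H = H] V_meas V01 prob_V)
  also have "\<dots> = (\<Sum>n\<le>m. c n * (a\<^sup>2 + (\<Sum>j<k n. e n j)))"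
    using c1 by (simp add: distrib_left sum.distrib flip: sum_distrib_right)
  also have "\<dots> \<le> (\<Sum>n\<le>m. c n * (9 / 4 * (1 / real (n + 1))))"
    unfolding e_def by (intro sum_mono mult_left_mono order_statistic_second_moment_le k c0)
  also have "\<dots> = 9 / 4 * (\<Sum>n\<le>m. c n * (1 / real (n + 1)))"
    by (simp add: sum_distrib_left mult_ac)
  also have "(\<Sum>n\<le>m. c n * (1 / real (n + 1))) = (1 - (1 - p) ^ (m + 1)) / (p * real (m + 1))" (is "_ = ?B")
    unfolding c_def using \<open>0 < p\<close> by (intro sum_binomial_pmf_inverse_Suc) simp
  finally have second: "\<Omega>.expectation (\<lambda>D. (V D - a)\<^sup>2) \<le> 9 / 4 * ?B" .
  have Va: "\<bar>V D - a\<bar> \<le> 1" for D using V01[of D] a by (auto simp: abs_if)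
  have int1: "integrable \<Omega> (\<lambda>D. V D - a)"
    using V_meas Va by (intro \<Omega>.integrable_const_bound[where B = 1]) auto
  have int2: "integrable \<Omega> (\<lambda>D. (V D - a)\<^sup>2)"
    using V_meas Va by (intro \<Omega>.integrable_const_bound[where B = 1]) (auto simp: abs_square_le_1)
  have "\<Omega>.expectation (\<lambda>D. \<bar>V D - a\<bar>) \<le> sqrt (\<Omega>.expectation (\<lambda>D. (V D - a)\<^sup>2))"
    by (rule expectation_abs_le_sqrt_second_moment[OF \<Omega>.prob_space_axioms int1 int2])
  also have "\<dots> \<le> sqrt (9 / 4 * ?B)" using second by simp
  also have "\<dots> = 3 / 2 * sqrt ?B"
    by (simp only: real_sqrt_mult) (simp add: real_sqrt_divide)
  finally have "ennreal (\<Omega>.expectation (\<lambda>D. \<bar>V D - a\<bar>)) \<le> ennreal (3 / 2 * sqrt ?B)"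
    by (rule ennreal_leI)
  moreover have "(\<integral>\<^sup>+D. ennreal \<bar>V D - a\<bar> \<partial>\<Omega>) = ennreal (\<Omega>.expectation (\<lambda>D. \<bar>V D - a\<bar>))"
    using int1 by (intro nn_integral_eq_integral integrable_abs) auto
  ultimately show ?thesis
    by (simp add: calibration_law_def coverage_def V_def q_def a_def \<Omega>_def N_def)
qed

theorem proposition7:
  fixes \<alpha> \<kappa> \<c> :: real and M P Q :: "'a measure" and x\<^sub>0 x\<^sub>D :: 'a and S :: "'a \<Rightarrow> real \<Rightarrow> real"
  assumes "0 < \<alpha>" and "\<alpha> < 1" and "0 < \<kappa>"
    and "x\<^sub>0 \<in> space M" and "x\<^sub>D \<in> space M" and "x\<^sub>0 \<noteq> x\<^sub>D"
    and "{x\<^sub>0} \<in> sets M" and "{x\<^sub>D} \<in> sets M"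
    and "Q = return M x\<^sub>0"
    and "P = measure_lincomb (1 / (1 + \<kappa>)) (return M x\<^sub>0) (\<kappa> / (1 + \<kappa>)) (return M x\<^sub>D)"
    and "S = (\<lambda>x y. \<bar>y\<bar> - (1 - \<alpha>))"
    and "\<c> = 1 + chi_square_div Q P"
  shows "\<c> = 1 + \<kappa> \<and> measure P {x\<^sub>0} = inverse \<c> \<and>
    (\<forall>m\<ge>1. \<forall>p::ennreal. 1 \<le> p \<longrightarrow>
      (SUP K\<in>admissible_kernels \<alpha> P.
         \<integral>\<^sup>+D. Lp_norm p Q (\<lambda>x.
             coverage K S (weighted_conformal_threshold \<alpha> (density_ratio Q P) S x\<^sub>0 m D) x - (1 - \<alpha>))
           \<partial>calibration_law m P K)
        \<le> ennreal (3/2 * sqrt (\<c> / real (m + 1) * (1 - (1 - inverse \<c>) ^ (m + 1)))) \<and>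
      3/2 * sqrt (\<c> / real (m + 1) * (1 - (1 - inverse \<c>) ^ (m + 1)))
        \<le> 3/2 * sqrt (\<c> / real (m + 1)))"
proof -
  have sets_P[simp, measurable_cong]: "sets P = sets M" and space_P: "space P = space M"
    by (simp_all add: assms(10))
  have em: "emeasure P A = ennreal (1 / (1 + \<kappa>)) * indicator A x\<^sub>0 + ennreal (\<kappa> / (1 + \<kappa>)) * indicator A x\<^sub>D"
    if "A \<in> sets M" for A
    using that by (simp add: assms(10) emeasure_measure_lincomb)
  have total: "1 / (1 + \<kappa>) + \<kappa> / (1 + \<kappa>) = 1"
    using \<open>0 < \<kappa>\<close> by (simp add: field_simps)
  interpret P: prob_space P
  proof
    have "emeasure P (space P) = ennreal (1 / (1 + \<kappa>)) + ennreal (\<kappa> / (1 + \<kappa>))"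
      using assms(4,5) by (simp add: space_P em)
    also have "\<dots> = 1" using \<open>0 < \<kappa>\<close> total by (simp flip: ennreal_plus)
    finally show "emeasure P (space P) = 1" .
  qed
  define w where "w = density_ratio Q P"
  have p0: "emeasure P {x\<^sub>0} = ennreal (1 / (1 + \<kappa>))" and pD: "emeasure P {x\<^sub>D} = ennreal (\<kappa> / (1 + \<kappa>))"
    using assms(6-8) by (simp_all add: em)
  have mp0: "measure P {x\<^sub>0} = 1 / (1 + \<kappa>)" and mpD: "measure P {x\<^sub>D} = \<kappa> / (1 + \<kappa>)"
    using p0 pD \<open>0 < \<kappa>\<close> by (simp_all add: measure_def)
  \<comment> \<open>the Radon--Nikodym derivative is pinned down at the two atoms by testing on singletons\<close>
  have dens: "density P (RN_deriv P Q) = Q"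
  proof (rule P.density_RN_deriv)
    show "absolutely_continuous P Q"
      unfolding absolutely_continuous_def
      using \<open>0 < \<kappa>\<close> assms(9) by (auto simp: null_sets_def em indicator_def split: if_splits)
    show "sets Q = sets P" by (simp add: assms(9))
  qed
  have RN: "RN_deriv P Q x * emeasure P {x} = emeasure Q {x}" if "{x} \<in> sets M" for x
  proof -
    have "emeasure Q {x} = (\<integral>\<^sup>+y. RN_deriv P Q y * indicator {x} y \<partial>P)"
      using that by (subst dens[symmetric], subst emeasure_density) auto
    then show ?thesis using that by (simp add: nn_integral_indicator_singleton)
  qed
  have w0: "w x\<^sub>0 = 1 + \<kappa>"
  proof -
    have "RN_deriv P Q x\<^sub>0 * ennreal (1 / (1 + \<kappa>)) = 1"
      using RN[OF assms(7)] assms(7,9) by (simp add: p0)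
    then have "enn2real (RN_deriv P Q x\<^sub>0) * (1 / (1 + \<kappa>)) = 1"
      using \<open>0 < \<kappa>\<close> by (metis add_pos_pos enn2real_1 enn2real_ennreal enn2real_mult less_eq_real_def zero_less_divide_1_iff zero_less_one)
    then show ?thesis using \<open>0 < \<kappa>\<close> by (simp add: w_def density_ratio_def field_simps)
  qed
  have wD: "w x\<^sub>D = 0"
  proof -
    have "RN_deriv P Q x\<^sub>D * ennreal (\<kappa> / (1 + \<kappa>)) = 0"
      using RN[OF assms(8)] assms(6,8,9) by (simp add: pD)
    then show ?thesis using \<open>0 < \<kappa>\<close> by (simp add: w_def density_ratio_def)
  qed
  have w_meas: "w \<in> borel_measurable P"
    unfolding w_def density_ratio_def by measurable
  have w_nonneg: "0 \<le> w x" for x by (simp add: w_def density_ratio_def)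
  have "chi_square_div Q P = (\<integral>x. \<kappa>\<^sup>2 * indicator {x\<^sub>0} x + indicator {x\<^sub>D} x \<partial>P)"
    unfolding chi_square_div_def w_def[symmetric]
  proof (rule integral_cong_AE)
    have "measure P ({x\<^sub>0} \<union> {x\<^sub>D}) = measure P {x\<^sub>0} + measure P {x\<^sub>D}"
      using assms(6-8) by (intro P.finite_measure_Union) auto
    moreover have "{x\<^sub>0} \<union> {x\<^sub>D} \<in> sets P" using assms(7,8) by (intro sets.Un) auto
    ultimately have "AE x in P. x \<in> {x\<^sub>0} \<union> {x\<^sub>D}"
      using total by (subst P.prob_eq_1[symmetric]) (simp_all only: mp0 mpD)
    then show "AE x in P. (w x - 1)\<^sup>2 = \<kappa>\<^sup>2 * indicator {x\<^sub>0} x + indicator {x\<^sub>D} x"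
      by eventually_elim (use assms(6) in \<open>auto simp: w0 wD\<close>)
  qed (use w_meas assms(7,8) in measurable)
  also have "\<dots> = \<kappa>\<^sup>2 * measure P {x\<^sub>0} + measure P {x\<^sub>D}"
    using assms(7,8) by (subst Bochner_Integration.integral_add) (auto simp: P.emeasure_eq_measure)
  also have "\<dots> = \<kappa> * (1 / (1 + \<kappa>) * \<kappa> + 1 / (1 + \<kappa>))"
    unfolding mp0 mpD by (simp add: power2_eq_square distrib_left mult_ac)
  also have "\<dots> = \<kappa>"
    using total by (simp add: add.commute)
  finally have c: "\<c> = 1 + \<kappa>" by (simp add: assms(12))
  have p: "measure P {x\<^sub>0} = inverse \<c>" "measure P {x\<^sub>D} = 1 - inverse \<c>"
    unfolding c mp0 mpD using \<open>0 < \<kappa>\<close> by (simp_all add: field_simps)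
  have kernel_bound: "(\<integral>\<^sup>+D. Lp_norm p Q (\<lambda>x.
        coverage K S (weighted_conformal_threshold \<alpha> w S x\<^sub>0 m D) x - (1 - \<alpha>)) \<partial>calibration_law m P K)
      \<le> ennreal (3/2 * sqrt (\<c> / real (m + 1) * (1 - (1 - inverse \<c>) ^ (m + 1))))"
    if "1 \<le> p" and K: "K \<in> admissible_kernels \<alpha> P" for m p K
  proof -
    have Km: "K \<in> P \<rightarrow>\<^sub>M prob_algebra borel" using K by (simp add: admissible_kernels_def)
    have Ks: "K \<in> M \<rightarrow>\<^sub>M subprob_algebra borel"
      using measurable_prob_algebraD[OF Km] by (simp add: measurable_cong_sets[OF sets_P refl])
    have "Lp_norm p Q (\<lambda>x. coverage K S q x - (1 - \<alpha>)) = ennreal \<bar>coverage K S q x\<^sub>0 - (1 - \<alpha>)\<bar>" for q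
      unfolding \<open>Q = return M x\<^sub>0\<close>
    proof (rule Lp_norm_return[OF _ \<open>x\<^sub>0 \<in> space M\<close> \<open>1 \<le> p\<close>])
      have "{y. ereal (\<bar>y\<bar> - (1 - \<alpha>)) \<le> q} \<in> sets borel" by measurable
      then have "(\<lambda>x. measure (K x) {y. ereal (\<bar>y\<bar> - (1 - \<alpha>)) \<le> q}) \<in> borel_measurable M"
        by (rule measurable_compose[OF Ks measurable_measure_subprob_algebra])
      then show "(\<lambda>x. coverage K S q x - (1 - \<alpha>)) \<in> borel_measurable M"
        unfolding coverage_def assms(11) by simp
    qed
    moreover have "(\<integral>\<^sup>+D. ennreal \<bar>coverage K S (weighted_conformal_threshold \<alpha> w S x\<^sub>0 m D) x\<^sub>0 - (1 - \<alpha>)\<bar>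
        \<partial>calibration_law m P K)
      \<le> ennreal (3 / 2 * sqrt ((1 - (1 - inverse \<c>) ^ (m + 1)) / (inverse \<c> * real (m + 1))))"
    proof (rule expected_coverage_error_le[where x\<^sub>D = x\<^sub>D and s\<^sub>1 = "- 1 - (1 - \<alpha>)"])
      show "(\<lambda>z. S (fst z) (snd z)) \<in> borel_measurable (P \<Otimes>\<^sub>M borel)"
        unfolding assms(11) by measurable
      have "x\<^sub>0 \<in> space P" using assms(4) by (simp add: space_P)
      interpret K0: prob_space "K x\<^sub>0"
        using measurable_space[OF Km \<open>x\<^sub>0 \<in> space P\<close>] by (auto simp: space_prob_algebra)
      have sK: "sets (K x\<^sub>0) = sets borel"
        using measurable_space[OF Km \<open>x\<^sub>0 \<in> space P\<close>] by (auto simp: space_prob_algebra)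
      have atom: "measure (K x\<^sub>0) {y} = 0" for y
        using K mp0 \<open>0 < \<kappa>\<close> assms(7) by (intro admissible_kernel_no_atoms[OF K P.prob_space_axioms]) auto
      \<comment> \<open>a level set of \<open>S x\<^sub>0\<close> has at most two points\<close>
      show "measure (K x\<^sub>0) {y. S x\<^sub>0 y = s} = 0" for s
      proof -
        let ?u = "s + (1 - \<alpha>)"
        have "measure (K x\<^sub>0) {y. S x\<^sub>0 y = s} \<le> measure (K x\<^sub>0) ({?u} \<union> {- ?u})"
          unfolding assms(11) by (intro K0.finite_measure_mono) (auto simp: sK)
        also have "\<dots> \<le> measure (K x\<^sub>0) {?u} + measure (K x\<^sub>0) {- ?u}"
          by (intro measure_Un_le) (auto simp: sK)
        finally show ?thesis using atom measure_nonneg by (simp add: antisym)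
      qed
      \<comment> \<open>the absolute residual score is bounded below by \<open>- (1 - \<alpha>)\<close>\<close>
      have empty: "{y. S x\<^sub>0 y \<le> - 1 - (1 - \<alpha>)} = {}" unfolding assms(11) by auto
      show "measure (K x\<^sub>0) {y. S x\<^sub>0 y \<le> - 1 - (1 - \<alpha>)} = 0" unfolding empty by simp
      show "0 < inverse \<c>" "0 < w x\<^sub>0" using \<open>0 < \<kappa>\<close> by (simp_all add: c w0)
    qed (use assms p Km w_meas w_nonneg wD P.prob_space_axioms in simp_all)
    moreover have "(1 - (1 - inverse \<c>) ^ (m + 1)) / (inverse \<c> * real (m + 1)) =
        \<c> / real (m + 1) * (1 - (1 - inverse \<c>) ^ (m + 1))"
      using c \<open>0 < \<kappa>\<close> by (simp add: field_simps)
    ultimately show ?thesis by (simp only:)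
  qed
  have second_bound: "3/2 * sqrt (\<c> / real (m + 1) * (1 - (1 - inverse \<c>) ^ (m + 1))) \<le> 3/2 * sqrt (\<c> / real (m + 1))" for m
  proof -
    have "inverse \<c> \<le> 1" "0 < \<c>" using c \<open>0 < \<kappa>\<close> by (simp_all add: field_simps)
    then have "\<c> / real (m + 1) * (1 - (1 - inverse \<c>) ^ (m + 1)) \<le> \<c> / real (m + 1) * 1"
      by (intro mult_left_mono) simp_all
    then show ?thesis by simp
  qed
  show ?thesis
    unfolding w_def[symmetric]
    using c p(1) kernel_bound second_bound by (auto intro!: SUP_least)
qed

end
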